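(* Let $\lambda\in\{-1,0\}$, let $p\ge0$ be an integer, $n\in\{1,2,\dots\}$, and let $\alpha=\alpha(n)\ge0$ with $\alpha(n)\to0$ as $n\to\infty$. Let $M>0$. For all $x\in I$, $x\neq0$, and all $f\in Lip_M^*(\beta)$ with $\beta\in(0,1]$, we have $$\left|L_n^{(\alpha)}(f;x)-f(x)\right|\le M\left(\frac{\phi_n^{(\alpha)}(x)}{x}\right)^{\beta/2},$$ where $\phi_n^{(\alpha)}(x)=L_n^{(\alpha)}\big((t-x)^2;x\big)$.
   Context: Factorial powers: $y^{[m,h]}=y(y-h)(y-2h)\cdots(y-(m-1)h)$ and $y^{[0,h]}=1$; thus $y^{[m,-\alpha]}=\prod_{i=0}^{m-1}(y+i\alpha)$. Interval: $I=[0,1]$ if $\lambda=-1$ and $I=[0,\infty)$ if $\lambda=0$. Operators: for a real-valued function $f$ and $x\in I$, $$L_n^{(\alpha)}(f;x)=\sum_k w_{n,k}^{(\alpha)}(x)\,f\!\left(\tfrac kn\right),$$ $$w_{n,k}^{(\alpha)}(x)=\frac{n+p}{n+p+(\lambda+1)k}\binom{n+p+(\lambda+1)k}{k}\frac{x^{[k,-\alpha]}(1+\lambda x)^{[n+p+\lambda k,-\alpha]}}{(1+(\lambda+1)x)^{[n+p+(\lambda+1)k,-\alpha]}},$$ where the sum is over $0\le k\le n+p$ if $\lambda=-1$ and over all integers $k\ge 0$ if $\lambda=0$. $L_n^{(\alpha)}(g(t);x)$ means the operator applied to the function $t\mapsto g(t)$, evaluated at $x$. $C_B(I)$ is the space of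 real-valued continuous and bounded functions on $I$, and $$Lip_M^*(\beta)=\left\{f\in C_B(I):\ |f(y)-f(x)|\le M\frac{|y-x|^{\beta}}{(x+y)^{\beta/2}};\ x,y\in(0,\infty)\right\},$$ where $M$ is a positive constant and $0<\beta\le1$. *)

theory Defs
  imports "HOL-Analysis.Analysis"
begin

definition fact_pow :: "real \<Rightarrow> nat \<Rightarrow> real \<Rightarrow> real" where
  "fact_pow y m h = (\<Prod>i<m. y - real i * h)"

definition interval_I :: "int \<Rightarrow> real set" where
  "interval_I l = (if l = -1 then {0..1} else {0..})"

definition index_set :: "int \<Rightarrow> nat \<Rightarrow> nat \<Rightarrow> nat set" where
  "index_set l p n = (if l = -1 then {0..n + p} else UNIV)"

text \<open>The conversions to \<^typ>\<open>nat\<close> below never truncate: for \<open>l = 0\<close> their arguments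
  are sums of naturals, and for \<open>l = -1\<close> only \<open>k \<le> n + p\<close> is used.\<close>

definition weight :: "int \<Rightarrow> nat \<Rightarrow> nat \<Rightarrow> real \<Rightarrow> nat \<Rightarrow> real \<Rightarrow> real" where
  "weight l p n \<alpha> k x =
     real (n + p) / (real (n + p) + real_of_int (l + 1) * real k)
     * real (nat (int n + int p + (l + 1) * int k) choose k)
     * (fact_pow x k (- \<alpha>)
        * fact_pow (1 + real_of_int l * x) (nat (int n + int p + l * int k)) (- \<alpha>)
        / fact_pow (1 + real_of_int (l + 1) * x) (nat (int n + int p + (l + 1) * int k)) (- \<alpha>))"

definition op_term ::
    "int \<Rightarrow> nat \<Rightarrow> nat \<Rightarrow> real \<Rightarrow> (real \<Rightarrow> real) \<Rightarrow> real \<Rightarrow> nat \<Rightarrow> real" where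
  "op_term l p n \<alpha> f x k = weight l p n \<alpha> k x * f (real k / real n)"

text \<open>For \<open>l = -1\<close> and \<open>p > 0\<close> some nodes \<open>k / n\<close> lie outside \<open>[0, 1]\<close>; the operator
  therefore acts on functions defined on all of \<^typ>\<open>real\<close>. When the series diverges,
  \<open>infsum\<close> is \<open>0\<close> by convention; \<open>op_defined\<close> excludes this case.\<close>

definition op_defined ::
    "int \<Rightarrow> nat \<Rightarrow> nat \<Rightarrow> real \<Rightarrow> (real \<Rightarrow> real) \<Rightarrow> real \<Rightarrow> bool" where
  "op_defined l p n \<alpha> f x \<longleftrightarrow> op_term l p n \<alpha> f x summable_on index_set l p n"

definition L_op :: "int \<Rightarrow> nat \<Rightarrow> nat \<Rightarrow> real \<Rightarrow> (real \<Rightarrow> real) \<Rightarrow> real \<Rightarrow> real" where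
  "L_op l p n \<alpha> f x = infsum (op_term l p n \<alpha> f x) (index_set l p n)"

definition phi :: "int \<Rightarrow> nat \<Rightarrow> nat \<Rightarrow> real \<Rightarrow> real \<Rightarrow> real" where
  "phi l p n \<alpha> x = L_op l p n \<alpha> (\<lambda>t. (t - x)\<^sup>2) x"

definition C_B :: "real set \<Rightarrow> (real \<Rightarrow> real) set" where
  "C_B S = {f. continuous_on S f \<and> bounded (f ` S)}"

text \<open>The Lipschitz inequality is required on all of \<open>(0, \<infinity>)\<close>, also when \<open>S = [0, 1]\<close>,
  so that it covers the nodes beyond \<open>1\<close>. A function satisfying it only on \<open>(0, 1]\<close>
  satisfies it on \<open>(0, \<infinity>)\<close> once extended by the constant \<open>f 1\<close>, because
  \<open>(y - x) / sqrt (x + y)\<close> increases in \<open>y\<close> for \<open>y > x\<close>.\<close>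

definition Lip_star :: "real set \<Rightarrow> real \<Rightarrow> real \<Rightarrow> (real \<Rightarrow> real) set" where
  "Lip_star S M \<beta> =
     {f \<in> C_B S. \<forall>x\<in>{0<..}. \<forall>y\<in>{0<..}.
        \<bar>f y - f x\<bar> \<le> M * (\<bar>y - x\<bar> powr \<beta> / (x + y) powr (\<beta> / 2))}"

end

theory Submission
  imports Defs
begin

text \<open>
  For \<open>x > 0\<close> the Lipschitz condition gives \<open>\<bar>f t - f x\<bar> \<le> M ((t - x)\<^sup>2 / x) powr (\<beta> / 2)\<close>
  for every \<open>t \<ge> 0\<close> (at \<open>t = 0\<close> by continuity). The weights are nonnegative and sum to \<open>1\<close>, so
  Jensen's inequality for the concave function \<open>s powr (\<beta> / 2)\<close> finishes the argument. The weights
  are the Polya urn distribution for \<open>\<lambda> = -1\<close>, where the total mass comes from Vandermonde's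
  identity, and the inverse Polya urn distribution for \<open>\<lambda> = 0\<close>, which counts the failures before
  the \<open>(n + p)\<close>-th success; there the total mass is found by induction on \<open>n + p\<close>.
\<close>

section \<open>Factorial powers\<close>

lemma fact_pow_0 [simp]: "fact_pow y 0 h = 1"
  and fact_pow_Suc: "fact_pow y (Suc m) h = fact_pow y m h * (y - real m * h)"
  by (simp_all add: fact_pow_def)

lemma fact_pow_pos:
  assumes "0 < y" "h \<le> 0"
  shows "0 < fact_pow y m h"
  unfolding fact_pow_def
proof (rule prod_pos)
  fix i
  show "0 < y - real i * h"
    using assms mult_nonneg_nonpos[of "real i" h] by linarith
qed

lemma fact_pow_nonneg:
  assumes "0 \<le> y" "h \<le> 0"
  shows "0 \<le> fact_pow y m h"
  unfolding fact_pow_def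
proof (rule prod_nonneg)
  fix i
  show "0 \<le> y - real i * h"
    using assms mult_nonneg_nonpos[of "real i" h] by linarith
qed

text \<open>Pulling \<open>- h\<close> out of each factor leaves a rising factorial with step 1, so
  identities for \<open>pochhammer\<close> become available.\<close>

lemma fact_pow_eq_pochhammer:
  assumes "h \<noteq> 0"
  shows "fact_pow y m h = (- h) ^ m * pochhammer (- y / h) m"
proof (induction m)
  case (Suc m)
  then show ?case
    using assms by (simp add: fact_pow_Suc pochhammer_Suc field_simps)
qed simp

lemma fact_pow_zero: "fact_pow y m 0 = y ^ m"
  by (simp add: fact_pow_def)

text \<open>Vandermonde's identity for rising factorials, rescaled by \<open>(- h) ^ m\<close>. The
  scaling degenerates at \<open>h = 0\<close>, where the binomial theorem takes over.\<close>

lemma fact_pow_add: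
  "fact_pow (x + y) m h = (\<Sum>k\<le>m. real (m choose k) * fact_pow x k h * fact_pow y (m - k) h)"
proof (cases "h = 0")
  case True
  then show ?thesis by (simp add: fact_pow_zero binomial_ring)
next
  case False
  have "pochhammer (- (x + y) / h) m
      = (\<Sum>k\<le>m. real (m choose k) * pochhammer (- x / h) k * pochhammer (- y / h) (m - k))"
    using pochhammer_binomial_sum[of "- x / h" "- y / h" m] by (simp add: add_divide_distrib diff_divide_distrib)
  then have "fact_pow (x + y) m h
      = (\<Sum>k\<le>m. (- h) ^ m * (real (m choose k) * pochhammer (- x / h) k * pochhammer (- y / h) (m - k)))"
    by (simp only: fact_pow_eq_pochhammer[OF False] sum_distrib_left)
  also have "\<dots> = (\<Sum>k\<le>m. real (m choose k) * fact_pow x k h * fact_pow y (m - k) h)"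
  proof (rule sum.cong)
    fix k assume "k \<in> {..m}"
    then have "(- h) ^ m = (- h) ^ k * (- h) ^ (m - k)"
      by (simp flip: power_add)
    then show "(- h) ^ m * (real (m choose k) * pochhammer (- x / h) k * pochhammer (- y / h) (m - k))
        = real (m choose k) * fact_pow x k h * fact_pow y (m - k) h"
      by (simp add: fact_pow_eq_pochhammer[OF False])
  qed simp
  finally show ?thesis .
qed

text \<open>The reciprocal is the product of the factors \<open>1 + y / (x - i h)\<close>, which dominates the
  divergent sum of \<open>y / (x - i h)\<close>.\<close>

lemma fact_pow_ratio_tendsto_0:
  assumes "0 < x" "0 < y" "h \<le> 0"
  shows "(\<lambda>k. fact_pow x k h / fact_pow (x + y) k h) \<longlonglongrightarrow> 0"
proof -
  define c where "c = y / (x - h)"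
  have c: "0 < c" using assms by (simp add: c_def)
  have lower: "1 + c * (\<Sum>i<k. 1 / real (Suc i)) \<le> fact_pow (x + y) k h / fact_pow x k h" for k
  proof (induction k)
    case (Suc k)
    define d where "d = x - real k * h"
    define q where "q = fact_pow (x + y) k h / fact_pow x k h"
    have hk: "real k * h \<le> 0" using assms by (simp add: mult_nonneg_nonpos)
    have d: "0 < d" using assms hk by (simp add: d_def)
    have "0 \<le> c * (\<Sum>i<k. 1 / real (Suc i))" using c by (intro mult_nonneg_nonneg sum_nonneg) auto
    then have q: "1 \<le> q" using Suc unfolding q_def by linarith
    \<comment> \<open>The two sides differ by \<open>x * real k - h\<close>, which is nonnegative.
      This linear growth of \<open>d\<close> is what allows the comparison with the harmonic
      series.\<close>
    have "d \<le> (x - h) * real (Suc k)"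
      using assms hk order_trans[of h 0 "x * real k"] by (simp add: d_def algebra_simps)
    then have "c * (1 / real (Suc k)) \<le> y / d"
      using d assms by (simp add: c_def frac_le)
    also have "\<dots> \<le> q * (y / d)"
      using mult_right_mono[OF q, of "y / d"] d assms by simp
    finally have "1 + c * (\<Sum>i<Suc k. 1 / real (Suc i)) \<le> q + q * (y / d)"
      using Suc by (simp add: q_def algebra_simps)
    also have "\<dots> = q * ((d + y) / d)" using d by (simp add: field_simps)
    also have "\<dots> = fact_pow (x + y) (Suc k) h / fact_pow x (Suc k) h"
      by (simp add: q_def d_def fact_pow_Suc algebra_simps)
    finally show ?case .
  qed simp
  have "filterlim (\<lambda>k. \<Sum>i<k. 1 / real (Suc i)) at_top sequentially"
    using harm_at_top by (simp add: harm_altdef[abs_def] inverse_eq_divide)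
  then have "filterlim (\<lambda>k. 1 + c * (\<Sum>i<k. 1 / real (Suc i))) at_top sequentially"
    using c by (intro filterlim_tendsto_add_at_top[OF tendsto_const]
        filterlim_tendsto_pos_mult_at_top[OF tendsto_const])
  then have "filterlim (\<lambda>k. fact_pow (x + y) k h / fact_pow x k h) at_top sequentially"
    by (rule filterlim_at_top_mono) (use lower in auto)
  then have "(\<lambda>k. inverse (fact_pow (x + y) k h / fact_pow x k h)) \<longlonglongrightarrow> 0"
    by (rule tendsto_inverse_0_at_top)
  then show ?thesis by simp
qed

section \<open>Total mass of the weights\<close>

text \<open>In the induction step, summation by parts compares the series for \<open>N + 1\<close> with the one for
  \<open>N\<close>; the boundary term is a multiple of \<open>k\<close> times the \<open>k\<close>-th term of a convergent series, so
  its limit, which exists by monotonicity, can only be \<open>0\<close>.\<close>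

lemma sums_choose_mult_difference_array:
  fixes r :: "nat \<Rightarrow> nat \<Rightarrow> real"
  assumes rec: "\<And>N k. r N k = r (Suc N) k + r N (Suc k)"
    and nonneg: "\<And>N k. 0 \<le> r N k"
    and lim: "r 0 \<longlonglongrightarrow> 0"
  shows "(\<lambda>k. real (N + k choose N) * r (Suc N) k) sums r 0 0"
proof (induction N)
  case 0
  \<comment> \<open>For \<open>N = 0\<close> the binomial coefficient is 1 and the recurrence makes
    the series telescope.\<close>
  have "(\<lambda>k. r 0 k - r 0 (Suc k)) sums (r 0 0 - 0)"
    by (rule telescope_sums'[OF lim])
  moreover have "r (Suc 0) k = r 0 k - r 0 (Suc k)" for k
    using rec[of 0 k] by simp
  ultimately show ?case by simp
next
  case (Suc N)
  define w where "w N k = real (N + k choose N) * r (Suc N) k" for N k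
  define b where "b k = real (N + k choose Suc N) * r (Suc N) k" for k
  have w_nonneg: "0 \<le> w M k" for M k using nonneg by (simp add: w_def)
  \<comment> \<open>Pascal's rule merges the coefficients of \<open>w N K\<close> and
    \<open>b K\<close>; \<open>rec\<close> then splits the result into \<open>w (Suc N) K\<close>
    and the next boundary term. The sum starts with \<open>b 0 = 0\<close>.\<close>
  have parts: "(\<Sum>k<K. w N k) = (\<Sum>k<K. w (Suc N) k) + b K" for K
  proof (induction K)
    case (Suc K)
    have "w N K + b K = real (Suc (N + K) choose Suc N) * r (Suc N) K"
      by (simp add: w_def b_def algebra_simps)
    also have "\<dots> = w (Suc N) K + b (Suc K)"
      by (subst rec) (simp add: w_def b_def algebra_simps del: binomial_Suc_Suc)
    finally show ?case using Suc by simp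
  qed (simp add: b_def)
  have N: "w N sums r 0 0" using Suc by (simp add: w_def[abs_def])
  have b_nonneg: "0 \<le> b k" for k using nonneg by (simp add: b_def)
  have "summable (w (Suc N))"
  proof (rule summableI_nonneg_bounded)
    fix K
    have "(\<Sum>k<K. w N k) \<le> r 0 0"
      using sum_le_suminf[OF sums_summable[OF N], of "{..<K}"] w_nonneg sums_unique[OF N] by simp
    then show "(\<Sum>k<K. w (Suc N) k) \<le> r 0 0" using parts[of K] b_nonneg[of K] by linarith
  qed (rule w_nonneg)
  then obtain s where s: "w (Suc N) sums s" by (auto simp: summable_def)
  have b_lim: "b \<longlonglongrightarrow> r 0 0 - s"
    using tendsto_diff[OF N[unfolded sums_def] s[unfolded sums_def]] by (simp add: parts)
  have b_w: "real (Suc N) * b k = real k * w N k" for k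
  proof -
    have "Suc N * (N + k choose Suc N) = k * (N + k choose N)"
      using binomial_absorption[of N "N + k"] binomial_absorb_comp[of "N + k" N] by simp
    then have "real (Suc N) * real (N + k choose Suc N) = real k * real (N + k choose N)"
      by (metis of_nat_mult)
    then show ?thesis unfolding b_def w_def by (metis mult.assoc)
  qed
  have "r 0 0 - s = 0"
  proof (rule ccontr)
    assume "r 0 0 - s \<noteq> 0"
    moreover have "0 \<le> r 0 0 - s"
      using b_lim by (rule LIMSEQ_le_const) (use b_nonneg in auto)
    ultimately have L: "0 < r 0 0 - s" by simp
    define e where "e = (r 0 0 - s) / 2"
    have e: "0 < e" "e < r 0 0 - s" using L by (auto simp: e_def)
    have "eventually (\<lambda>k. e < b k) sequentially"
      using order_tendstoD(1)[OF b_lim e(2)] .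
    \<comment> \<open>Once \<open>b k\<close> exceeds \<open>e\<close>, the identity
      \<open>b_w\<close> bounds \<open>w N k\<close> below by a positive multiple of
      \<open>1 / k\<close>, so the harmonic series would converge.\<close>
    then have "eventually (\<lambda>k. norm (inverse (real k)) \<le> w N k / (real (Suc N) * e)) sequentially"
      using eventually_gt_at_top[of 0]
    proof eventually_elim
      case (elim k)
      have "real (Suc N) * e \<le> real k * w N k"
        using elim b_w[of k] mult_left_mono[of e "b k" "real (Suc N)"] by simp
      moreover have "0 < real (Suc N) * e" using e by simp
      ultimately show ?case using elim by (simp add: pos_le_divide_eq divide_inverse[symmetric] pos_divide_le_eq mult.commute inverse_eq_divide)
    qed
    then have "summable (\<lambda>k. inverse (real k))"
      by (rule summable_comparison_test_ev) (intro summable_divide sums_summable[OF N])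
    then show False using not_summable_harmonic[where 'a = real] by simp
  qed
  then show ?case using s by (simp add: w_def[abs_def])
qed

text \<open>In the urn model \<open>r N k\<close> is the probability of a fixed sequence with
  \<open>N\<close> successes and \<open>k\<close> failures. Its recurrence conditions on the next
  draw, and \<open>r 0 k\<close> tends to 0 because an endless run of failures has probability 0.
  The coefficient counts the orders of the draws before the last success.\<close>

lemma inverse_polya_sums:
  assumes "0 < x" "0 < y" "h \<le> 0"
  shows "(\<lambda>k. real (N + k choose N) *
    (fact_pow x k h * fact_pow y (Suc N) h / fact_pow (x + y) (Suc N + k) h)) sums 1"
proof -
  define r where "r N k = fact_pow x k h * fact_pow y N h / fact_pow (x + y) (N + k) h" for N k
  have pos: "0 < fact_pow (x + y) k h" for k
    using assms by (intro fact_pow_pos) auto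
  have "r N k = r (Suc N) k + r N (Suc k)" for N k
  proof -
    define d where "d = x + y - real (N + k) * h"
    have "0 < d"
      using assms mult_nonneg_nonpos[of "real (N + k)" h] unfolding d_def by linarith
    moreover have "r (Suc N) k + r N (Suc k)
        = fact_pow x k h * fact_pow y N h * d / (fact_pow (x + y) (N + k) h * d)"
      unfolding r_def add_Suc add_Suc_right fact_pow_Suc add_divide_distrib[symmetric] d_def
      by (simp add: algebra_simps)
    ultimately show ?thesis by (simp add: r_def)
  qed
  moreover have "0 \<le> r N k" for N k
    unfolding r_def using assms pos
    by (intro divide_nonneg_pos mult_nonneg_nonneg fact_pow_nonneg) auto
  moreover have "r 0 \<longlonglongrightarrow> 0"
    using fact_pow_ratio_tendsto_0[OF assms] by (simp add: r_def[abs_def])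
  ultimately have "(\<lambda>k. real (N + k choose N) * r (Suc N) k) sums r 0 0"
    by (rule sums_choose_mult_difference_array)
  then show ?thesis by (simp add: r_def)
qed

section \<open>The operator's weights as urn distributions\<close>

lemma weight_minus_one:
  assumes "0 < n + p" "k \<le> n + p"
  shows "weight (- 1) p n \<alpha> k x = real (n + p choose k) * fact_pow x k (- \<alpha>)
    * fact_pow (1 - x) (n + p - k) (- \<alpha>) / fact_pow 1 (n + p) (- \<alpha>)"
proof -
  have "nat (int n + int p) = n + p" "nat (int n + int p - int k) = n + p - k"
    using assms by (auto simp: nat_diff_distrib)
  \<comment> \<open>The leading quotient is \<open>(n + p) / (n + p)\<close>; it equals 1 only for a
    nonzero denominator, since division by zero gives 0.\<close>
  moreover have "real n + real p \<noteq> 0" using assms(1) by linarith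
  ultimately show ?thesis unfolding weight_def by simp
qed

text \<open>The absorption identity turns the quotient times the binomial coefficient into the
  negative binomial coefficient, matching \<open>inverse_polya_sums\<close> with
  \<open>y = 1\<close>.\<close>

lemma weight_zero:
  assumes "n + p = Suc m"
  shows "weight 0 p n \<alpha> k x = real (m + k choose m) *
    (fact_pow x k (- \<alpha>) * fact_pow 1 (Suc m) (- \<alpha>) / fact_pow (x + 1) (Suc m + k) (- \<alpha>))"
proof -
  have nats: "nat (int n + int p + 0 * int k) = Suc m" "nat (int n + int p + (0 + 1) * int k) = Suc m + k"
    using assms by (simp_all add: nat_eq_iff)
  have weight: "weight 0 p n \<alpha> k x = real (Suc m) / (real (Suc m) + real k) * real (Suc m + k choose k)
      * (fact_pow x k (- \<alpha>) * fact_pow 1 (Suc m) (- \<alpha>) / fact_pow (x + 1) (Suc m + k) (- \<alpha>))"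
    unfolding weight_def nats assms by (simp add: add.commute)
  have "Suc m * (Suc m + k choose k) = (Suc m + k) * (m + k choose m)"
    using Suc_times_binomial[of m "m + k"] binomial_symmetric[of k "Suc m + k"] by simp
  then have "real (Suc m) * real (Suc m + k choose k) = real (Suc m + k) * real (m + k choose m)"
    by (metis of_nat_mult)
  then have "real (Suc m) / (real (Suc m) + real k) * real (Suc m + k choose k) = real (m + k choose m)"
    by (simp add: field_simps)
  then show ?thesis by (simp only: weight)
qed

lemma weight_nonneg:
  assumes "l \<in> {- 1, 0}" "1 \<le> n" "0 \<le> \<alpha>" "x \<in> interval_I l" "k \<in> index_set l p n"
  shows "0 \<le> weight l p n \<alpha> k x"
proof (cases "l = - 1")
  case True
  then have "k \<le> n + p" using assms by (simp add: index_set_def)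
  then show ?thesis
    using assms True
    by (simp add: weight_minus_one interval_I_def fact_pow_nonneg fact_pow_pos less_imp_le)
next
  case False
  obtain m where "n + p = Suc m" using assms by (cases "n + p") auto
  then show ?thesis
    using assms False by (simp add: weight_zero interval_I_def fact_pow_nonneg)
qed

lemma weight_has_sum_1:
  assumes "l \<in> {- 1, 0}" "1 \<le> n" "0 \<le> \<alpha>" "x \<in> interval_I l" "x \<noteq> 0"
  shows "((\<lambda>k. weight l p n \<alpha> k x) has_sum 1) (index_set l p n)"
proof (cases "l = - 1")
  case True
  have "(\<Sum>k\<le>n + p. weight l p n \<alpha> k x)
      = (\<Sum>k\<le>n + p. real (n + p choose k) * fact_pow x k (- \<alpha>) * fact_pow (1 - x) (n + p - k) (- \<alpha>))
        / fact_pow 1 (n + p) (- \<alpha>)"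
    unfolding sum_divide_distrib True using assms by (intro sum.cong) (auto simp: weight_minus_one)
  \<comment> \<open>Vandermonde with the arguments \<open>x\<close> and \<open>1 - x\<close>, whose
    sum is 1.\<close>
  also have "\<dots> = 1"
    using assms fact_pow_pos[of 1 "- \<alpha>" "n + p"] by (simp flip: fact_pow_add)
  finally show ?thesis
    using True by (simp add: has_sum_finite_iff index_set_def atMost_atLeast0)
next
  case False
  then have l: "l = 0" and x: "0 < x" using assms by (auto simp: interval_I_def)
  obtain m where m: "n + p = Suc m" using assms by (cases "n + p") auto
  have "(\<lambda>k. weight l p n \<alpha> k x) sums 1"
    unfolding l weight_zero[OF m] using x assms by (intro inverse_polya_sums) auto
  \<comment> \<open>Nonnegativity upgrades the ordered series to an unordered sum.\<close>
  then have "((\<lambda>k. weight l p n \<alpha> k x) has_sum 1) UNIV"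
    using weight_nonneg[of l n \<alpha> x] assms l
    by (intro sums_nonneg_imp_has_sum) (auto simp: index_set_def)
  then show ?thesis using l by (simp add: index_set_def)
qed

section \<open>Jensen's inequality and the Lipschitz condition\<close>

text \<open>Concavity as a tangent bound: after division by \<open>c powr (1 - \<gamma>)\<close>,
  the right side is the tangent to \<open>s powr \<gamma>\<close> at \<open>s = c\<close>.\<close>

lemma powr_le_weighted_sum:
  fixes s c \<gamma> :: real
  assumes "0 \<le> s" "0 < c" "0 < \<gamma>" "\<gamma> < 1"
  shows "s powr \<gamma> * c powr (1 - \<gamma>) \<le> \<gamma> * s + (1 - \<gamma>) * c"
proof (cases "s = 0")
  case False
  then show ?thesis using assms Youngs_inequality_0[of \<gamma> "1 - \<gamma>" s c] by simp
qed (use assms in simp)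

text \<open>The tangent bound is averaged against \<open>w\<close>. Tangency at 1 already gives
  summability; tangency at the mean \<open>G\<close> gives the sharp inequality.\<close>

lemma powr_jensen_has_sum:
  fixes w g :: "'a \<Rightarrow> real"
  assumes w: "(w has_sum 1) A" "\<And>k. k \<in> A \<Longrightarrow> 0 \<le> w k"
    and g: "((\<lambda>k. w k * g k) has_sum G) A" "\<And>k. k \<in> A \<Longrightarrow> 0 \<le> g k"
    and \<gamma>: "0 < \<gamma>" "\<gamma> < 1"
  shows "(\<lambda>k. w k * g k powr \<gamma>) summable_on A"
    and "infsum (\<lambda>k. w k * g k powr \<gamma>) A \<le> G powr \<gamma>"
proof -
  have young: "w k * g k powr \<gamma> * c powr (1 - \<gamma>) \<le> \<gamma> * (w k * g k) + (1 - \<gamma>) * c * w k"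
    if "k \<in> A" "0 < c" for k c
    using mult_left_mono[OF powr_le_weighted_sum[OF g(2)[OF that(1)] that(2) \<gamma>] w(2)[OF that(1)]]
    by (simp add: algebra_simps)
  have rhs: "((\<lambda>k. \<gamma> * (w k * g k) + (1 - \<gamma>) * c * w k) has_sum (\<gamma> * G + (1 - \<gamma>) * c)) A" for c
    using has_sum_add[OF has_sum_cmult_right[OF g(1), of \<gamma>] has_sum_cmult_right[OF w(1), of "(1 - \<gamma>) * c"]]
    by simp
  show summable: "(\<lambda>k. w k * g k powr \<gamma>) summable_on A"
  proof (rule summable_on_comparison_test)
    show "(\<lambda>k. \<gamma> * (w k * g k) + (1 - \<gamma>) * 1 * w k) summable_on A"
      using rhs[of 1] by (rule has_sum_imp_summable)
    show "w k * g k powr \<gamma> \<le> \<gamma> * (w k * g k) + (1 - \<gamma>) * 1 * w k" if "k \<in> A" for k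
      using young[OF that, of 1] by simp
  qed (use w in auto)
  have "0 \<le> G" using g(1) by (rule has_sum_nonneg) (use w g in auto)
  then consider "G = 0" | "0 < G" by linarith
  then show "infsum (\<lambda>k. w k * g k powr \<gamma>) A \<le> G powr \<gamma>"
  proof cases
    case 1
    \<comment> \<open>There is no tangent at 0, so \<open>G = 0\<close> is separate:
      \<open>g\<close> vanishes wherever \<open>w\<close> does not, and
      \<open>0 powr \<gamma> = 0\<close>.\<close>
    have "w k * g k = 0" if "k \<in> A" for k
      using nonneg_has_sum_le_0D[OF g(1)] w g 1 that by simp
    then have "infsum (\<lambda>k. w k * g k powr \<gamma>) A = 0"
      by (intro infsum_0) auto
    then show ?thesis by simp
  next
    case 2
    have "infsum (\<lambda>k. w k * g k powr \<gamma>) A * G powr (1 - \<gamma>)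
        = infsum (\<lambda>k. w k * g k powr \<gamma> * G powr (1 - \<gamma>)) A"
      by (simp add: infsum_cmult_left')
    also have "\<dots> \<le> \<gamma> * G + (1 - \<gamma>) * G"
      using has_sum_mono[OF has_sum_infsum[OF summable_on_cmult_left[OF summable]] rhs] young 2 by blast
    also have "\<dots> = G powr \<gamma> * G powr (1 - \<gamma>)"
      using 2 by (simp add: algebra_simps flip: powr_add)
    finally show ?thesis using 2 by simp
  qed
qed

text \<open>Replacing \<open>x + y\<close> by the smaller \<open>x\<close> leaves a power of the
  squared distance alone, whose mean is controlled by \<open>phi\<close>.\<close>

lemma Lip_star_powr_bound:
  assumes f: "f \<in> Lip_star (interval_I l) M \<beta>"
    and x: "x \<in> interval_I l" "x \<noteq> 0" and "0 \<le> t" "0 < M" "0 < \<beta>"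
  shows "\<bar>f t - f x\<bar> \<le> M * ((t - x)\<^sup>2 / x) powr (\<beta> / 2)"
proof -
  have x0: "0 < x" using x by (auto simp: interval_I_def split: if_splits)
  have bound: "\<bar>f y - f x\<bar> \<le> M * ((y - x)\<^sup>2 / x) powr (\<beta> / 2)" if "0 < y" for y
  proof -
    have "\<bar>y - x\<bar> powr \<beta> = (\<bar>y - x\<bar> powr 2) powr (\<beta> / 2)" unfolding powr_powr by simp
    also have "\<bar>y - x\<bar> powr 2 = (y - x)\<^sup>2" by (cases "y = x") (auto simp: powr_numeral)
    finally have sq: "\<bar>y - x\<bar> powr \<beta> = ((y - x)\<^sup>2) powr (\<beta> / 2)" .
    have "\<bar>f y - f x\<bar> \<le> M * (\<bar>y - x\<bar> powr \<beta> / (x + y) powr (\<beta> / 2))"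
      using f that x0 by (auto simp: Lip_star_def)
    also have "\<dots> = M * ((y - x)\<^sup>2 / (x + y)) powr (\<beta> / 2)"
      using that x0 by (simp add: sq powr_divide)
    also have "\<dots> \<le> M * ((y - x)\<^sup>2 / x) powr (\<beta> / 2)"
      using that x0 assms by (intro mult_left_mono powr_mono2 divide_left_mono) auto
    finally show ?thesis .
  qed
  show ?thesis
  proof (cases "t = 0")
    case True
    \<comment> \<open>The Lipschitz condition says nothing at 0; right continuity there carries the
      bound over from positive points.\<close>
    have "{0..x} \<subseteq> interval_I l" using x by (auto simp: interval_I_def split: if_splits)
    then have "continuous_on {0..x} f"
      using f unfolding Lip_star_def C_B_def by (blast intro: continuous_on_subset)
    then have "(f \<longlongrightarrow> f 0) (at_right 0)"
      using x0 by (rule continuous_on_Icc_at_rightD)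
    then have lhs: "((\<lambda>y. \<bar>f y - f x\<bar>) \<longlongrightarrow> \<bar>f 0 - f x\<bar>) (at_right 0)"
      by (intro tendsto_intros)
    have rhs: "((\<lambda>y. M * ((y - x)\<^sup>2 / x) powr (\<beta> / 2)) \<longlongrightarrow> M * ((0 - x)\<^sup>2 / x) powr (\<beta> / 2)) (at_right 0)"
      using x0 by (intro tendsto_intros) auto
    have "\<bar>f 0 - f x\<bar> \<le> M * ((0 - x)\<^sup>2 / x) powr (\<beta> / 2)"
      by (rule tendsto_le[OF _ rhs lhs])
        (auto intro: bound eventually_at_right_less[THEN eventually_mono])
    then show ?thesis using True by simp
  qed (use assms bound in simp)
qed

section \<open>The error estimate\<close>

theorem theorem4p2:
  fixes l :: int and p n :: nat and \<alpha> :: "nat \<Rightarrow> real"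
    and M \<beta> x :: real and f :: "real \<Rightarrow> real"
  assumes "l \<in> {-1, 0}"
    and "n \<ge> 1"
    and "\<And>m. m \<ge> 1 \<Longrightarrow> \<alpha> m \<ge> 0"
    and "\<alpha> \<longlonglongrightarrow> 0"
    and "M > 0"
    and "x \<in> interval_I l" and "x \<noteq> 0"
    and "0 < \<beta>" and "\<beta> \<le> 1"
    and "f \<in> Lip_star (interval_I l) M \<beta>"
    and "op_defined l p n (\<alpha> n) (\<lambda>t. (t - x)\<^sup>2) x"
  shows "\<bar>L_op l p n (\<alpha> n) f x - f x\<bar> \<le> M * (phi l p n (\<alpha> n) x / x) powr (\<beta> / 2)"
proof -
  let ?A = "index_set l p n"
  define w where "w k = weight l p n (\<alpha> n) k x" for k
  define t where "t k = real k / real n" for k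
  define g where "g k = (t k - x)\<^sup>2 / x" for k
  have x: "0 < x" using assms(6,7) by (auto simp: interval_I_def split: if_splits)
  have \<alpha>: "0 \<le> \<alpha> n" using assms(2,3) by simp
  have w: "(w has_sum 1) ?A"
    unfolding w_def[abs_def] using assms \<alpha> by (intro weight_has_sum_1) auto
  have w_nonneg: "0 \<le> w k" if "k \<in> ?A" for k
    unfolding w_def using assms \<alpha> that by (intro weight_nonneg) auto
  \<comment> \<open>Here \<open>op_defined\<close> ensures that \<open>phi\<close> is the actual
    second moment and not the default value of \<open>infsum\<close>.\<close>
  have "((\<lambda>k. w k * (t k - x)\<^sup>2) has_sum phi l p n (\<alpha> n) x) ?A"
    using has_sum_infsum[OF assms(11)[unfolded op_defined_def]]
    by (simp add: phi_def L_op_def op_term_def[abs_def] w_def t_def)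
  then have wg: "((\<lambda>k. w k * g k) has_sum (phi l p n (\<alpha> n) x / x)) ?A"
    using has_sum_divide_const[of "\<lambda>k. w k * (t k - x)\<^sup>2"] by (simp add: g_def)
  have g_nonneg: "0 \<le> g k" for k using x by (simp add: g_def)
  have \<gamma>: "0 < \<beta> / 2" "\<beta> / 2 < 1" using assms(8,9) by auto
  note jensen = powr_jensen_has_sum[OF w w_nonneg wg g_nonneg \<gamma>]
  have bound: "norm (w k * (f (t k) - f x)) \<le> M * (w k * g k powr (\<beta> / 2))" if "k \<in> ?A" for k
  proof -
    \<comment> \<open>For \<open>l = -1\<close> and \<open>p > 0\<close> some nodes exceed 1; the
      bound holds for every nonnegative node.\<close>
    have "\<bar>f (t k) - f x\<bar> \<le> M * g k powr (\<beta> / 2)"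
      unfolding g_def using assms by (intro Lip_star_powr_bound) (auto simp: t_def)
    then show ?thesis
      using mult_left_mono[OF _ w_nonneg[OF that]] w_nonneg[OF that]
      by (fastforce simp: abs_mult mult.left_commute)
  qed
  have dom: "((\<lambda>k. M * (w k * g k powr (\<beta> / 2))) has_sum
      (M * infsum (\<lambda>k. w k * g k powr (\<beta> / 2)) ?A)) ?A"
    by (intro has_sum_cmult_right has_sum_infsum jensen(1))
  have abs_summable: "(\<lambda>k. norm (w k * (f (t k) - f x))) summable_on ?A"
    using has_sum_imp_summable[OF dom] by (rule Infinite_Sum.abs_summable_on_comparison_test') (rule bound)
  let ?D = "infsum (\<lambda>k. w k * (f (t k) - f x)) ?A"
  \<comment> \<open>Adding back \<open>f x\<close> times the total mass 1 shows that the series of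
    \<open>L_op\<close> for \<open>f\<close> converges, so its \<open>infsum\<close> is a genuine
    sum.\<close>
  have "((\<lambda>k. w k * (f (t k) - f x) + w k * f x) has_sum (?D + 1 * f x)) ?A"
    using Infinite_Sum.abs_summable_summable[OF abs_summable]
    by (intro has_sum_add has_sum_infsum has_sum_cmult_left w)
  then have "(op_term l p n (\<alpha> n) f x has_sum (?D + f x)) ?A"
    by (simp add: op_term_def[abs_def] w_def t_def algebra_simps)
  then have "L_op l p n (\<alpha> n) f x - f x = ?D"
    by (simp add: L_op_def infsumI)
  also have "\<bar>?D\<bar> \<le> infsum (\<lambda>k. norm (w k * (f (t k) - f x))) ?A"
    using norm_infsum_bound[OF abs_summable] by simp
  also have "\<dots> \<le> M * infsum (\<lambda>k. w k * g k powr (\<beta> / 2)) ?A"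
    by (rule has_sum_mono[OF has_sum_infsum[OF abs_summable] dom]) (rule bound)
  also have "\<dots> \<le> M * (phi l p n (\<alpha> n) x / x) powr (\<beta> / 2)"
    using jensen(2) assms(5) by simp
  finally show ?thesis .
qed

end
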